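(* Let $L$ be a $BL$-algebra and $F:L\to[0,1]$ a fuzzy set. Then $F$ is an $(\overline{\in},\overline{\in}\vee\overline{q})$-fuzzy filter of $L$ if and only if for all $x,y\in L$: (a) $\max\{F(x\odot y),0.5\}\ge\min\{F(x),F(y)\}$, and (b) if $x\le y$ then $\max\{F(y),0.5\}\ge F(x)$.
   Context: A $BL$-algebra is an algebra $(L,\le,\wedge,\vee,\odot,\rightarrow,0,1)$ that is a bounded lattice (least element $0$, greatest element $1$) such that $(L,\odot,1)$ is a commutative monoid, $z\le x\rightarrow y$ iff $x\odot z\le y$, $x\wedge y=x\odot(x\rightarrow y)$, and $(x\rightarrow y)\vee(y\rightarrow x)=1$, for all $x,y,z\in L$. For $x\in L$ and $t\in(0,1]$, the fuzzy point $U(x;t)$ is said to belong to $F$, written $U(x;t)\in F$, if $F(x)\ge t$, and to be quasi-coincident with $F$, written $U(x;t)\,q\,F$, if $F(x)+t>1$; $\overline{\in}$ and $\overline{q}$ denote the negations of these relations, and $U(x;t)\,\overline{\in}\vee\overline{q}\,F$ means $U(x;t)\,\overline{\in}\,F$ or $U(x;t)\,\overline{q}\,F$. A fuzzy set $F$ is an $(\overline{\in},\overline{\in}\vee\overline{q})$-fuzzy filter of $L$ if for all $t,r\in(0,1]$ and $x,y\in L$: (i) if $U(x\odot y;\min\{t,r\})\,\overline{\in}\,F$ then $U(x;t)\,\overline{\in}\vee\overline{q}\,F$ or $U(y;r)\,\overline{\in}\vee\overline{q}\,F$; (ii) if $x\le y$ and $U(y;r)\,\overline{\in}\,F$ then $U(x;r)\,\overline{\in}\vee\overline{q}\,F$.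 *)

theory Defs
  imports Complex_Main
begin

text \<open>
  A BL-algebra lives on a whole type. Order and lattice operations are those of
  \<^class>\<open>bounded_lattice\<close> (with least element \<^term>\<open>bot\<close> in the role of $0$), the
  commutative monoid $(L, \odot, 1)$ is that of \<^class>\<open>comm_monoid_mult\<close>, and the axiom
  \<open>one_eq_top\<close> says that the monoid unit is the greatest element.
\<close>

class bl_algebra = bounded_lattice + comm_monoid_mult +
  fixes residuum :: "'a \<Rightarrow> 'a \<Rightarrow> 'a"  (infixr "\<leadsto>" 60)
  assumes one_eq_top: "1 = top"
    and residuation: "z \<le> (x \<leadsto> y) \<longleftrightarrow> x * z \<le> y"
    and divisibility: "inf x y = x * (x \<leadsto> y)"
    and prelinearity: "sup (x \<leadsto> y) (y \<leadsto> x) = 1"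

definition fuzzy_set :: "('a \<Rightarrow> real) \<Rightarrow> bool" where
  "fuzzy_set F \<longleftrightarrow> (\<forall>x. 0 \<le> F x \<and> F x \<le> 1)"

text \<open>
  The fuzzy point $U(x;t)$ is represented by the pair of arguments \<open>x\<close>, \<open>t\<close>; the
  restriction $t \in (0,1]$ is imposed where the points are quantified over.
\<close>

definition pt_belongs :: "'a \<Rightarrow> real \<Rightarrow> ('a \<Rightarrow> real) \<Rightarrow> bool" where
  "pt_belongs x t F \<longleftrightarrow> F x \<ge> t"

definition pt_quasi_coincident :: "'a \<Rightarrow> real \<Rightarrow> ('a \<Rightarrow> real) \<Rightarrow> bool" where
  "pt_quasi_coincident x t F \<longleftrightarrow> F x + t > 1"

definition pt_not_belongs_or_not_quasi :: "'a \<Rightarrow> real \<Rightarrow> ('a \<Rightarrow> real) \<Rightarrow> bool" where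
  "pt_not_belongs_or_not_quasi x t F \<longleftrightarrow>
     \<not> pt_belongs x t F \<or> \<not> pt_quasi_coincident x t F"

definition nbelongs_nbelongs_or_nquasi_fuzzy_filter :: "('a::bl_algebra \<Rightarrow> real) \<Rightarrow> bool" where
  "nbelongs_nbelongs_or_nquasi_fuzzy_filter F \<longleftrightarrow>
     (\<forall>t\<in>{0<..1}. \<forall>r\<in>{0<..1}. \<forall>x y.
        (\<not> pt_belongs (x * y) (min t r) F \<longrightarrow>
           pt_not_belongs_or_not_quasi x t F \<or> pt_not_belongs_or_not_quasi y r F) \<and>
        (x \<le> y \<and> \<not> pt_belongs y r F \<longrightarrow> pt_not_belongs_or_not_quasi x r F))"

end

theory Submission imports Defs begin

text \<open>
  A point that both belongs to and is quasi-coincident with \<open>F\<close> has value above \<open>1/2\<close>, where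
  the maximum with \<open>1/2\<close> in the two inequalities is irrelevant. Conversely, if an inequality
  fails, its smaller side is below \<open>t = min (F x) (F y)\<close> (respectively \<open>t = F x\<close>), and
  \<open>t > 1/2\<close>; fuzzy points of height \<open>t\<close> then violate the filter condition.
\<close>

lemma not_belongs_or_not_quasi_iff:
  "pt_not_belongs_or_not_quasi x t F \<longleftrightarrow> F x < t \<or> F x \<le> 1 - t"
  by (auto simp: pt_not_belongs_or_not_quasi_def pt_belongs_def pt_quasi_coincident_def)

theorem theorem2p3:
  fixes F :: "'a::bl_algebra \<Rightarrow> real"
  assumes "fuzzy_set F"
  shows "nbelongs_nbelongs_or_nquasi_fuzzy_filter F \<longleftrightarrow>
    (\<forall>x y. max (F (x * y)) 0.5 \<ge> min (F x) (F y) \<and>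
           (x \<le> y \<longrightarrow> max (F y) 0.5 \<ge> F x))"
proof
  assume filter: "nbelongs_nbelongs_or_nquasi_fuzzy_filter F"
  have le1: "F x \<le> 1" for x
    using assms by (simp add: fuzzy_set_def)
  \<comment> \<open>Taking \<open>r = t\<close> collapses \<open>min t r\<close> to a single
    height.\<close>
  have mult: "F x < t \<or> F x \<le> 1 - t \<or> F y < t \<or> F y \<le> 1 - t"
    if "0 < t" "t \<le> 1" "F (x * y) < t" for x y t
    using filter that
    unfolding nbelongs_nbelongs_or_nquasi_fuzzy_filter_def not_belongs_or_not_quasi_iff
      pt_belongs_def
    by (metis greaterThanAtMost_iff min.idem not_le)
  have mono: "F x < t \<or> F x \<le> 1 - t"
    if "0 < t" "t \<le> 1" "x \<le> y" "F y < t" for x y t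
    using filter that
    unfolding nbelongs_nbelongs_or_nquasi_fuzzy_filter_def not_belongs_or_not_quasi_iff
      pt_belongs_def
    by (metis greaterThanAtMost_iff not_le)
  show "\<forall>x y. max (F (x * y)) 0.5 \<ge> min (F x) (F y) \<and>
              (x \<le> y \<longrightarrow> max (F y) 0.5 \<ge> F x)"
  proof (intro allI conjI impI)
    fix x y
    show "max (F (x * y)) 0.5 \<ge> min (F x) (F y)"
      \<comment> \<open>Neither value is below this \<open>t\<close>, so \<open>mult\<close> leaves
        \<open>t\<close> \<le> \<open>1 - t\<close>, against \<open>t > 1/2\<close>;
        \<open>le1\<close> keeps \<open>t\<close> in range.\<close>
      using mult[of "min (F x) (F y)" x y] le1[of x] le1[of y]
      by (simp add: max_def min_def split: if_splits; linarith)
  next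
    fix x y :: 'a
    assume "x \<le> y"
    then show "max (F y) 0.5 \<ge> F x"
      using mono[of "F x" x y] le1[of x] by (simp add: max_def; linarith)
  qed
next
  assume bounds: "\<forall>x y. max (F (x * y)) 0.5 \<ge> min (F x) (F y) \<and>
                        (x \<le> y \<longrightarrow> max (F y) 0.5 \<ge> F x)"
  show "nbelongs_nbelongs_or_nquasi_fuzzy_filter F"
    unfolding nbelongs_nbelongs_or_nquasi_fuzzy_filter_def not_belongs_or_not_quasi_iff
      pt_belongs_def
  proof (intro ballI allI conjI impI)
    fix t r :: real and x y
    assume "\<not> min t r \<le> F (x * y)"
    moreover have "max (F (x * y)) 0.5 \<ge> min (F x) (F y)"
      using bounds by blast
    \<comment> \<open>Otherwise adding \<open>F x\<close> \<ge> \<open>t\<close> to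
      \<open>F x > 1 - t\<close> gives \<open>F x > 1/2\<close>, likewise for \<open>y\<close>, so
      \<open>F (x * y)\<close> \<ge> \<open>min (F x) (F y)\<close> \<ge>
      \<open>min t r\<close>.\<close>
    ultimately show "(F x < t \<or> F x \<le> 1 - t) \<or> F y < r \<or> F y \<le> 1 - r"
      by (simp add: max_def min_def split: if_splits; linarith)
  next
    fix r :: real and x y
    assume "x \<le> y \<and> \<not> r \<le> F y"
    moreover from this have "max (F y) 0.5 \<ge> F x"
      using bounds by blast
    ultimately show "F x < r \<or> F x \<le> 1 - r"
      by (simp add: max_def split: if_splits; linarith)
  qed
qed

end
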